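(* Let $\{p_s : s>0\}$ be a scale family of probability densities with common support $\mathcal{X}\subseteq\mathbb{R}$, i.e. for a standard density $p$ and a fixed location $l_0\in\mathbb{R}$, $p_s(x)=\frac{1}{s}\,p\left(\frac{x-l_0}{s}\right)$. Then for all $s_1,s_2>0$ and all $\lambda>0$, $$\mathrm{KL}(p_{\lambda s_1}:p_{\lambda s_2})=\mathrm{KL}(p_{s_1}:p_{s_2}).$$
   Context: All densities are probability densities with respect to Lebesgue measure on $\mathbb{R}$; a density has support $\mathcal{X}$ if it is positive on $\mathcal{X}$ and zero outside $\mathcal{X}$. For two densities $p,q$ with the same support $\mathcal{X}$, the Kullback-Leibler divergence is $\mathrm{KL}(p:q)=\int_{\mathcal{X}}p(x)\log\frac{p(x)}{q(x)}\,dx\in[0,+\infty]$ (it may be infinite). *)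

theory Defs
  imports "HOL-Probability.Probability"
begin

definition prob_density :: "(real \<Rightarrow> real) \<Rightarrow> bool" where
  "prob_density p \<longleftrightarrow>
     p \<in> borel_measurable lebesgue \<and> (\<forall>x. 0 \<le> p x) \<and> (\<integral>\<^sup>+ x. ennreal (p x) \<partial>lebesgue) = 1"

definition has_support :: "(real \<Rightarrow> real) \<Rightarrow> real set \<Rightarrow> bool" where
  "has_support p X \<longleftrightarrow> (\<forall>x\<in>X. 0 < p x) \<and> (\<forall>x. x \<notin> X \<longrightarrow> p x = 0)"

definition scale_density :: "(real \<Rightarrow> real) \<Rightarrow> real \<Rightarrow> real \<Rightarrow> real \<Rightarrow> real" where
  "scale_density p l0 s x = (1 / s) * p ((x - l0) / s)"

(* Positive part minus negative part, so that the value may be infinite; the library's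
   KL_divergence is real-valued and returns 0 when the integral diverges. For densities with
   support X the negative part is at most 1 (KL_negative_part_le_1), so \<infinity> - \<infinity> does not occur. *)
definition KL :: "real set \<Rightarrow> (real \<Rightarrow> real) \<Rightarrow> (real \<Rightarrow> real) \<Rightarrow> ereal" where
  "KL X p q =
     enn2ereal (\<integral>\<^sup>+ x\<in>X. ennreal (p x * ln (p x / q x)) \<partial>lebesgue)
   - enn2ereal (\<integral>\<^sup>+ x\<in>X. ennreal (- (p x * ln (p x / q x))) \<partial>lebesgue)"

lemma KL_negative_part_le_1:
  assumes "has_support p X" "prob_density q" "has_support q X"
  shows "(\<integral>\<^sup>+ x\<in>X. ennreal (- (p x * ln (p x / q x))) \<partial>lebesgue) \<le> 1"
proof -
  have "- (p x * ln (p x / q x)) \<le> q x" if "x \<in> X" for x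
  proof -
    have pos: "0 < p x" "0 < q x"
      using assms(1,3) that by (auto simp: has_support_def)
    have "p x * ln (q x / p x) \<le> p x * (q x / p x - 1)"
      using pos by (intro mult_left_mono ln_le_minus_one) auto
    also have "\<dots> = q x - p x"
      using pos by (simp add: field_simps)
    finally show ?thesis
      using pos by (simp add: ln_div algebra_simps)
  qed
  then have "(\<integral>\<^sup>+ x\<in>X. ennreal (- (p x * ln (p x / q x))) \<partial>lebesgue) \<le> (\<integral>\<^sup>+ x. ennreal (q x) \<partial>lebesgue)"
    by (intro nn_integral_mono) (auto simp: indicator_def intro!: ennreal_leI)
  then show ?thesis
    using assms(2) by (simp add: prob_density_def)
qed

end

theory Submission
  imports Defs
begin

text \<open>
  Let \<open>T x = l0 + lam (x - l0)\<close> be the dilation with centre \<open>l0\<close> and ratio \<open>lam\<close>. The density with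
  scale \<open>s\<close> is the pullback of the density with scale \<open>lam s\<close> along \<open>T\<close>, that is, the composition
  with \<open>T\<close> times the Jacobian \<open>lam\<close>. Pulling back both arguments of the divergence leaves the
  likelihood ratio unchanged apart from the substitution \<open>x \<mapsto> T x\<close>, so the claim is the change of
  variables formula for \<open>T\<close> (lemma \<open>KL_dilation\<close>). The domain of integration stays the same because
  it is the support of every member of the family: comparing the scales \<open>1\<close> and \<open>lam\<close>
  shows that \<open>T\<close> maps \<open>X\<close> and its complement into themselves (lemma \<open>common_support_dilation\<close>).

  Positive and negative parts of the integrand are transformed separately as integrals
  of nonnegative functions, so infinite divergences are covered as well.
\<close>

lemma dilation_measurable_lebesgue:
  fixes l c :: real
  assumes "c \<noteq> 0"
  shows "(\<lambda>x. l + c * (x - l)) \<in> lebesgue \<rightarrow>\<^sub>M lebesgue"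
  using lebesgue_affine_measurable[of "\<lambda>_::real. c" "l - c * l"] assms
  by (simp add: algebra_simps)

lemma set_nn_integral_dilation:
  fixes l c :: real
  assumes g: "g \<in> borel_measurable lebesgue" and X: "X \<in> sets lebesgue"
    and inv: "\<And>x. l + c * (x - l) \<in> X \<longleftrightarrow> x \<in> X" and c: "c > 0"
  shows "(\<integral>\<^sup>+ x\<in>X. g x \<partial>lebesgue) = ennreal c * (\<integral>\<^sup>+ x\<in>X. g (l + c * (x - l)) \<partial>lebesgue)"
proof -
  have affine: "l - c * l + c * x = l + c * (x - l)" for x
    by (simp add: algebra_simps)
  have "(\<lambda>x. g x * indicator X x) \<in> borel_measurable lebesgue"
    using g X by measurable
  from nn_integral_real_affine_lebesgue[OF this, of c "l - c * l"] c
  show ?thesis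
    by (simp add: affine inv indicator_def)
qed

text \<open>
  Both densities acquire the same Jacobian factor \<open>c\<close>, which cancels in their ratio; the factor that
  remains in front of the logarithm is the one demanded by the change of variables.
\<close>

lemma KL_dilation:
  fixes l c :: real
  assumes f: "f \<in> borel_measurable lebesgue" and h: "h \<in> borel_measurable lebesgue"
    and X: "X \<in> sets lebesgue"
    and inv: "\<And>x. l + c * (x - l) \<in> X \<longleftrightarrow> x \<in> X" and c: "c > 0"
  shows "KL X (\<lambda>x. c * f (l + c * (x - l))) (\<lambda>x. c * h (l + c * (x - l))) = KL X f h"
proof -
  define T where "T x = l + c * (x - l)" for x
  define F where "F x = f x * ln (f x / h x)" for x
  have F: "F \<in> borel_measurable lebesgue"
    unfolding F_def using f h by measurable
  have integrand: "c * f (T x) * ln (c * f (T x) / (c * h (T x))) = c * F (T x)" for x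
    using c by (simp add: F_def)
  have change_of_variables:
    "(\<integral>\<^sup>+ x\<in>X. ennreal (c * G (T x)) \<partial>lebesgue) = (\<integral>\<^sup>+ x\<in>X. ennreal (G x) \<partial>lebesgue)"
    if G: "G \<in> borel_measurable lebesgue" for G :: "real \<Rightarrow> real"
  proof -
    have "(\<lambda>x. G (T x)) \<in> borel_measurable lebesgue"
      unfolding T_def using c by (intro measurable_compose[OF dilation_measurable_lebesgue G]) simp
    then have GT: "(\<lambda>x. ennreal (G (T x)) * indicator X x) \<in> borel_measurable lebesgue"
      using X by measurable
    have "(\<integral>\<^sup>+ x\<in>X. ennreal (c * G (T x)) \<partial>lebesgue)
        = ennreal c * (\<integral>\<^sup>+ x\<in>X. ennreal (G (T x)) \<partial>lebesgue)"
      using c GT by (simp add: ennreal_mult' mult.assoc nn_integral_cmult)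
    also have "\<dots> = (\<integral>\<^sup>+ x\<in>X. ennreal (G x) \<partial>lebesgue)"
      unfolding T_def using G
      by (intro set_nn_integral_dilation[symmetric] X inv c) measurable
    finally show ?thesis .
  qed
  have "(\<lambda>x. - F x) \<in> borel_measurable lebesgue"
    using F by measurable
  from change_of_variables[OF F] change_of_variables[OF this] show ?thesis
    unfolding KL_def T_def[symmetric] integrand by (simp add: F_def)
qed

lemma has_support_mem_iff: "has_support q X \<Longrightarrow> x \<in> X \<longleftrightarrow> 0 < q x"
  by (auto simp: has_support_def)

lemma scale_density_dilation:
  assumes "lam > 0"
  shows "lam * scale_density p l (lam * s) (l + lam * (x - l)) = scale_density p l s x"
  using assms by (simp add: scale_density_def)

lemma common_support_dilation:
  assumes supp: "\<And>s. s > 0 \<Longrightarrow> has_support (scale_density p l s) X" and lam: "lam > 0"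
  shows "l + lam * (x - l) \<in> X \<longleftrightarrow> x \<in> X"
proof -
  have "x \<in> X \<longleftrightarrow> 0 < lam * scale_density p l lam (l + lam * (x - l))"
    using has_support_mem_iff[OF supp[of 1], of x] scale_density_dilation[OF lam, of p l 1 x] by simp
  also have "\<dots> \<longleftrightarrow> l + lam * (x - l) \<in> X"
    using has_support_mem_iff[OF supp[OF lam]] lam by (simp add: zero_less_mult_iff)
  finally show ?thesis ..
qed

lemma scale_density_measurable:
  assumes p: "p \<in> borel_measurable lebesgue" and s: "s > 0"
  shows "scale_density p l s \<in> borel_measurable lebesgue"
proof -
  have "(\<lambda>x. - l / s + (1 / s) * x) \<in> lebesgue \<rightarrow>\<^sub>M lebesgue"
    using lebesgue_affine_measurable[of "\<lambda>_::real. 1 / s" "- l / s"] s by simp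
  moreover have "- l / s + (1 / s) * x = (x - l) / s" for x
    by (simp add: diff_divide_distrib)
  ultimately have "(\<lambda>x. p ((x - l) / s)) \<in> borel_measurable lebesgue"
    using measurable_compose[OF _ p] by simp
  then show ?thesis
    unfolding scale_density_def[abs_def] by measurable
qed

theorem theorem1:
  fixes p :: "real \<Rightarrow> real" and l0 :: real and X :: "real set" and s1 s2 lam :: real
  assumes "prob_density p"
    and "\<And>s. s > 0 \<Longrightarrow> has_support (scale_density p l0 s) X"
    and "s1 > 0" and "s2 > 0" and "lam > 0"
  shows "KL X (scale_density p l0 (lam * s1)) (scale_density p l0 (lam * s2))
       = KL X (scale_density p l0 s1) (scale_density p l0 s2)"
proof -
  have meas: "scale_density p l0 s \<in> borel_measurable lebesgue" if "s > 0" for s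
    using assms(1) that by (simp add: prob_density_def scale_density_measurable)
  have "X = {x \<in> space lebesgue. 0 < scale_density p l0 1 x}"
    using has_support_mem_iff[OF assms(2)[of 1]] by auto
  also have "\<dots> \<in> sets lebesgue"
    using meas[of 1] by measurable
  finally have X: "X \<in> sets lebesgue" .
  have pullback: "scale_density p l0 s
      = (\<lambda>x. lam * scale_density p l0 (lam * s) (l0 + lam * (x - l0)))" for s
    using scale_density_dilation[OF assms(5)] by auto
  show ?thesis
    unfolding pullback[of s1] pullback[of s2]
    using assms(3-5)
    by (intro KL_dilation[symmetric] meas X common_support_dilation[OF assms(2)]) auto
qed

end
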